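(* Let $\mathcal{G}$ be a finite connected graph and consider the Markov jump process on its vertices with rates $k(x,y)$, where $k(x,y)>0$ if $\{x,y\}$ is an edge of $\mathcal{G}$ and $k(x,y)=0$ otherwise. Let $\rho^s$ be its unique stationary probability distribution. For every edge $\{x,y\}$ of $\mathcal{G}$, the stationary current $J(x,y)=\rho^s(x)k(x,y)-\rho^s(y)k(y,x)$ satisfies $$J(x,y)=\frac{1}{W}\sum_{\ell_{xy}}\sum_{H_{\ell_{xy}}}W(H_{\ell_{xy}})\left(w(\ell_{xy}^{x\to y})-w(\ell_{xy}^{y\to x})\right),$$ where the first sum is over all loops $\ell_{xy}$ of $\mathcal{G}$ containing the edge $\{x,y\}$ and the second sum is over all collections of hairs $H_{\ell_{xy}}$ towards the loop $\ell_{xy}$.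
   Context: The stationary distribution is the probability distribution $\rho$ with $\sum_y [k(x,y)\rho(x)-k(y,x)\rho(y)]=0$ for all $x$. For a spanning tree $\mathcal{T}$ of $\mathcal{G}$, $\mathcal{T}_x$ is the in-tree to $x$, obtained by orienting every edge of $\mathcal{T}$ towards $x$. The normalization is $W=\sum_{x}\sum_{\mathcal{T}}\prod_{(z,z')\in\mathcal{T}_x}k(z,z')$, summed over all vertices $x$ and all spanning trees $\mathcal{T}$. A loop is a simple (undirected) cycle of $\mathcal{G}$, of length at least $3$. If the loop $\ell$ contains the edge $\{x,y\}$, then $\ell^{x\to y}$ is $\ell$ oriented as a directed cycle so that it traverses the edge from $x$ to $y$, and $\ell^{y\to x}$ is the opposite orientation. $w(\cdot)$ of a directed cycle is the product of the rates $k(z,z')$ over its directed edges. A collection of hairs $H_\ell$ towards a loop $\ell$ is a set of directed edges of $\mathcal{G}$ forming a spanning forest oriented towards $\ell$: every vertex not on $\ell$ has exactly one outgoing edge in $H_\ell$, vertices on $\ell$ have none, and following the edges of $H_\ell$ from any vertex not on $\ell$ one reaches a vertex of $\ell$. Its weight is $W(H_\ell)=\prod_{(z,z')\in H_\ell}k(z,z')$, with $W(H_\ell)=1$ when $H_\ell$ is empty (no hairs). *)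

theory Defs
  imports Complex_Main "Graph_Theory.Graph_Theory"
begin

text \<open>
  A finite simple graph is a \<^locale>\<open>pair_graph\<close>: an undirected edge $\{u,v\}$ is the pair of
  arcs \<open>(u,v)\<close>, \<open>(v,u)\<close>.
\<close>

text \<open>
  A loop is undirected, so it is represented by its symmetric set of arcs, not by a walk. The
  bound on the length excludes the closed walks $u,v,u$, which \<^const>\<open>pre_digraph.cycle\<close> admits.
\<close>

definition loops :: "'a pair_pre_digraph \<Rightarrow> 'a rel set" where
  "loops G = {symcl (set p) | p. pre_digraph.cycle (with_proj G) p \<and> 3 \<le> length p}"

definition loops_through :: "'a pair_pre_digraph \<Rightarrow> 'a \<Rightarrow> 'a \<Rightarrow> 'a rel set" where
  "loops_through G x y = {L \<in> loops G. (x, y) \<in> L}"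

text \<open>A loop has exactly two orientations, and exactly one of them contains the arc \<open>(x,y)\<close>.\<close>

definition oriented_loop :: "'a pair_pre_digraph \<Rightarrow> 'a rel \<Rightarrow> 'a \<Rightarrow> 'a \<Rightarrow> 'a rel" where
  "oriented_loop G L x y =
    (THE C. (\<exists>p. pre_digraph.cycle (with_proj G) p \<and> C = set p) \<and> symcl C = L \<and> (x, y) \<in> C)"

text \<open>
  The constant \<^const>\<open>tree\<close> of the library forbids directed cycles only: no symmetric digraph with
  an arc satisfies it, whereas an acyclic orientation of a triangle does. Hence the separate
  notion of an undirected spanning tree.
\<close>

definition spanning_trees :: "'a pair_pre_digraph \<Rightarrow> 'a pair_pre_digraph set" where
  "spanning_trees G =
    {T. pair_graph T \<and> spanning (with_proj T) (with_proj G)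
      \<and> Digraph_Component.connected (with_proj T) \<and> loops T = {}}"

text \<open>An edge \<open>(z,z')\<close> is oriented towards \<open>x\<close> if the path in \<open>T\<close> from \<open>z\<close> to \<open>x\<close> starts with it.\<close>

definition in_tree :: "'a pair_pre_digraph \<Rightarrow> 'a \<Rightarrow> 'a rel" where
  "in_tree T x = {(z, z'). \<exists>p. pre_digraph.apath (with_proj T) z ((z, z') # p) x}"

definition hairs :: "'a pair_pre_digraph \<Rightarrow> 'a rel \<Rightarrow> 'a rel set" where
  "hairs G L =
    {H. H \<subseteq> parcs G
      \<and> (\<forall>z \<in> pverts G - Field L. \<exists>!z'. (z, z') \<in> H)
      \<and> (\<forall>z \<in> Field L. \<forall>z'. (z, z') \<notin> H)
      \<and> (\<forall>z \<in> pverts G - Field L. \<exists>v \<in> Field L. (z, v) \<in> H\<^sup>*)}"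

definition weight :: "('a \<Rightarrow> 'a \<Rightarrow> real) \<Rightarrow> 'a rel \<Rightarrow> real" where
  "weight k A = (\<Prod>(z, z') \<in> A. k z z')"

definition normalization :: "'a pair_pre_digraph \<Rightarrow> ('a \<Rightarrow> 'a \<Rightarrow> real) \<Rightarrow> real" where
  "normalization G k = (\<Sum>x \<in> pverts G. \<Sum>T \<in> spanning_trees G. weight k (in_tree T x))"

definition jump_rates :: "'a pair_pre_digraph \<Rightarrow> ('a \<Rightarrow> 'a \<Rightarrow> real) \<Rightarrow> bool" where
  "jump_rates G k \<longleftrightarrow>
    (\<forall>x \<in> pverts G. \<forall>y \<in> pverts G.
      ((x, y) \<in> parcs G \<longrightarrow> 0 < k x y) \<and> ((x, y) \<notin> parcs G \<longrightarrow> k x y = 0))"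

definition stationary_distribution ::
    "'a pair_pre_digraph \<Rightarrow> ('a \<Rightarrow> 'a \<Rightarrow> real) \<Rightarrow> ('a \<Rightarrow> real) \<Rightarrow> bool" where
  "stationary_distribution G k \<rho> \<longleftrightarrow>
    (\<forall>x \<in> pverts G. 0 \<le> \<rho> x) \<and> (\<Sum>x \<in> pverts G. \<rho> x) = 1
    \<and> (\<forall>x \<in> pverts G. (\<Sum>y \<in> pverts G. k x y * \<rho> x - k y x * \<rho> y) = 0)"

definition current :: "('a \<Rightarrow> 'a \<Rightarrow> real) \<Rightarrow> ('a \<Rightarrow> real) \<Rightarrow> 'a \<Rightarrow> 'a \<Rightarrow> real" where
  "current k \<rho> x y = \<rho> x * k x y - \<rho> y * k y x"

end

theory Submission
  imports Defs
begin

text \<open>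
  Write $\tau(x)$ for the total weight of the in-trees to $x$. Adding an arc $(x,y)$ to an in-tree
  to $x$ gives a set of arcs with one arc out of every vertex and a unique directed cycle, which
  passes through $(x,y)$; every such set arises exactly once. Summing their weights over the arc
  out of $x$ on the cycle, or over the arc into $x$ on it, gives
  $\tau(x)\sum_y k(x,y) = \sum_y \tau(y)k(y,x)$, so that $\rho^s = \tau/W$ by uniqueness. In
  $\tau(x)k(x,y) - \tau(y)k(y,x)$ the sets whose cycle is $x,y,x$ cancel, and every other set is an
  oriented loop through the edge together with hairs towards it.
\<close>

text \<open>The obstacle is that spanning trees and loops are given through graphs and walks,
  whereas adding and deleting arcs calls for plain arc sets. Cycles therefore become relations and
  trees become forests with a root set: \<open>in_forests G {x}\<close> holds the in-trees to
  \<open>x\<close>, and \<open>in_forests G (Field L)\<close> the hairs towards \<open>L\<close>.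
  The passage from a spanning tree to its in-tree is a bijection because the symmetric closure
  undoes it. An arc set with one arc out of every vertex acts as a deterministic motion, and this
  carries most arguments: the vertices reachable from \<open>x\<close> are exactly those on the
  cycle through \<open>x\<close>, so cycle and hairs can be read off from the set, and
  \<open>x\<close> has one predecessor on its cycle although several hairs may also enter it.
  Uniqueness of the stationary distribution comes from a minimum principle and not from
  determinants.\<close>

section \<open>Cycles, forests and unicyclic sets as arc sets\<close>

definition directed_cycle :: "'a rel \<Rightarrow> bool" where
  "directed_cycle C \<longleftrightarrow> C \<noteq> {} \<and> single_valued C \<and> single_valued (C\<inverse>)
    \<and> (\<forall>u \<in> Field C. \<forall>v \<in> Field C. (u, v) \<in> C\<^sup>*)"

definition oriented_cycles :: "'a pair_pre_digraph \<Rightarrow> 'a rel set" where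
  "oriented_cycles G = {C. C \<subseteq> parcs G \<and> directed_cycle C \<and> C \<inter> C\<inverse> = {}}"

definition in_forests :: "'a pair_pre_digraph \<Rightarrow> 'a set \<Rightarrow> 'a rel set" where
  "in_forests G R =
    {H. H \<subseteq> parcs G
      \<and> (\<forall>z \<in> pverts G - R. \<exists>!z'. (z, z') \<in> H)
      \<and> (\<forall>z \<in> R. \<forall>z'. (z, z') \<notin> H)
      \<and> (\<forall>z \<in> pverts G - R. \<exists>v \<in> R. (z, v) \<in> H\<^sup>*)}"

text \<open>The arc out of \<open>x\<close> leads to a vertex that reaches \<open>x\<close> again,
  so for a vertex \<open>x\<close> of the graph the cycle passes through \<open>x\<close>; it is the
  only one, since every vertex of a cycle reaches \<open>x\<close> and determinism keeps the motion
  on that cycle.\<close>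

definition unicyclic :: "'a pair_pre_digraph \<Rightarrow> 'a \<Rightarrow> 'a rel set" where
  "unicyclic G x =
    {B. B \<subseteq> parcs G \<and> (\<forall>z \<in> pverts G. \<exists>!z'. (z, z') \<in> B) \<and> (\<forall>z \<in> pverts G. (z, x) \<in> B\<^sup>*)}"

lemma hairs_eq_in_forests: "hairs G L = in_forests G (Field L)"
  by (simp add: hairs_def in_forests_def)

lemma mem_symcl_iff: "(a, b) \<in> symcl C \<longleftrightarrow> (a, b) \<in> C \<or> (b, a) \<in> C"
  by (auto simp: symcl_def)

lemma Field_symcl: "Field (symcl C) = Field C"
  by (auto simp: Field_def Domain_iff Range_iff mem_symcl_iff)

lemma symcl_converse: "symcl (C\<inverse>) = symcl C"
  by (auto simp: mem_symcl_iff)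

lemma weight_Un:
  assumes "finite A" "finite B" "A \<inter> B = {}"
  shows "weight k (A \<union> B) = weight k A * weight k B"
  using assms by (simp add: weight_def prod.union_disjoint)

lemma weight_insert:
  assumes "finite A" "(x, y) \<notin> A"
  shows "weight k (insert (x, y) A) = k x y * weight k A"
  using assms by (simp add: weight_def)


section \<open>Relations\<close>

lemma rtrancl_closed:
  assumes "(a, b) \<in> r\<^sup>*" "a \<in> S" "\<And>u v. u \<in> S \<Longrightarrow> (u, v) \<in> r \<Longrightarrow> v \<in> S"
  shows "b \<in> S"
  using assms(1,2) by induction (auto intro: assms(3))

text \<open>Stop the path at its first vertex in \<open>R\<close>. This shows that deleting all arcs
  out of a root set leaves a forest towards it.\<close>

lemma rtrancl_first_hit:
  assumes "(z, x) \<in> B\<^sup>*" "x \<in> R"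
  shows "\<exists>v \<in> R. (z, v) \<in> (B - R \<times> UNIV)\<^sup>*"
  using assms
proof (induction rule: converse_rtrancl_induct)
  case (step a b)
  then obtain v where "v \<in> R" "(b, v) \<in> (B - R \<times> UNIV)\<^sup>*" by blast
  with step.hyps(1) show ?case
    by (cases "a \<in> R") (auto intro: converse_rtrancl_into_rtrancl)
qed blast

text \<open>A deterministic motion started on a cycle cannot leave it: the arc from \<open>w\<close>
  to \<open>w'\<close> is also the first arc of the way back from \<open>w\<close> to
  \<open>v\<close>.\<close>

lemma single_valued_cycle_back:
  assumes "single_valued B" "(v, v) \<in> B\<^sup>+" "(v, w) \<in> B\<^sup>*"
  shows "(w, v) \<in> B\<^sup>+"
  using assms(3)
proof induction
  case (step w w')
  from step.IH obtain u where u: "(w, u) \<in> B" "(u, v) \<in> B\<^sup>*" by (meson tranclD)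
  with step.hyps(2) assms(1) have "u = w'" by (auto dest: single_valuedD)
  with u(2) assms(2) show ?case by (auto simp: rtrancl_eq_or_trancl)
qed (use assms(2) in simp)

lemma relpow_mult_fixed:
  assumes "(c, c) \<in> B ^^ m"
  shows "(c, c) \<in> B ^^ (m * n)"
proof (induction n)
  case (Suc n)
  with assms have "(c, c) \<in> B ^^ m O B ^^ (m * n)" by blast
  then show ?case by (simp only: relpow_add mult_Suc_right)
qed simp

text \<open>If \<open>a\<close> and \<open>b\<close> are reached from \<open>c\<close> in
  \<open>i\<close> and \<open>j\<close> steps, then \<open>c\<close> returns after
  \<open>Suc i\<close> and after \<open>Suc j\<close> steps. Hence both \<open>a\<close> and
  \<open>b\<close> are where the motion from \<open>c\<close> stands after
  \<open>Suc i * Suc j - 1\<close> steps.\<close>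

lemma single_valued_cycle_pred_unique:
  assumes sv: "single_valued B" and "(c, a) \<in> B\<^sup>*" "(c, b) \<in> B\<^sup>*" and arcs: "(a, c) \<in> B" "(b, c) \<in> B"
  shows "a = b"
proof -
  from assms(2,3) obtain i j where i: "(c, a) \<in> B ^^ i" and j: "(c, b) \<in> B ^^ j"
    by (meson rtrancl_power)
  have "(c, c) \<in> B ^^ Suc i" "(c, c) \<in> B ^^ Suc j" using i j arcs by auto
  then have "(c, c) \<in> B ^^ (Suc i * j)" "(c, c) \<in> B ^^ (Suc j * i)"
    by (blast intro: relpow_mult_fixed)+
  with i j have "(c, a) \<in> B ^^ (Suc i * j) O B ^^ i" "(c, b) \<in> B ^^ (Suc j * i) O B ^^ j" by blast+
  then have "(c, a) \<in> B ^^ (Suc i * j + i)" "(c, b) \<in> B ^^ (Suc j * i + j)"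
    by (simp_all only: relpow_add)
  moreover have "Suc i * j + i = Suc j * i + j" by simp
  ultimately show "a = b"
    using single_valued_relpow[OF sv] by (metis single_valuedD)
qed


section \<open>Simple paths and cycles\<close>

lemma pawalk_verts_heads: "pcas u p v \<Longrightarrow> pawalk_verts u p = u # map snd p"
  by (induction p arbitrary: u) auto

lemma pawalk_verts_tails: "pcas u p v \<Longrightarrow> pawalk_verts u p = map fst p @ [v]"
  by (induction p arbitrary: u) auto

lemma pcas_append_iff: "pcas u (p @ q) w \<longleftrightarrow> (\<exists>v. pcas u p v \<and> pcas v q w)"
  by (induction p arbitrary: u) auto

lemma pcas_reachable:
  assumes "pcas u p v" "w \<in> set (pawalk_verts u p)"
  shows "(u, w) \<in> (set p)\<^sup>* \<and> (w, v) \<in> (set p)\<^sup>*"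
  using assms
proof (induction p arbitrary: u w)
  case (Cons e p)
  have e: "e = (u, snd e)" and p: "pcas (snd e) p v" using Cons.prems(1) by (auto simp: prod_eq_iff)
  have mono: "(set p)\<^sup>* \<subseteq> (set (e # p))\<^sup>*" by (intro rtrancl_mono) auto
  have arc: "(u, snd e) \<in> set (e # p)" using e by (metis list.set_intros(1))
  show ?case
  proof (cases "w = u")
    case True
    have "(snd e, v) \<in> (set p)\<^sup>*"
      using Cons.IH[OF p, of "snd e"] by (cases p) (use p in auto)
    with mono arc True show ?thesis by (meson converse_rtrancl_into_rtrancl rtrancl.rtrancl_refl subsetD)
  next
    case False
    with Cons.prems e have "w \<in> set (pawalk_verts (snd e) p)" by (auto simp: prod_eq_iff)
    with Cons.IH[OF p] mono arc show ?thesis by (meson converse_rtrancl_into_rtrancl subsetD)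
  qed
qed auto

lemma simple_path_suffix:
  assumes "pcas u p v" "distinct (pawalk_verts u p)" "w \<in> set (pawalk_verts u p)"
  shows "\<exists>q. pcas w q v \<and> set q \<subseteq> set p \<and> distinct (pawalk_verts w q)"
  using assms
proof (induction p arbitrary: u)
  case (Cons e p)
  show ?case
  proof (cases "w = u")
    case True
    with Cons.prems show ?thesis by blast
  next
    case False
    with Cons.prems have "w \<in> set (pawalk_verts (snd e) p)" by auto
    with Cons.IH[of "snd e"] Cons.prems show ?thesis by fastforce
  qed
qed auto

lemma rtrancl_simple_path:
  assumes "(u, v) \<in> R\<^sup>*"
  shows "\<exists>p. pcas u p v \<and> set p \<subseteq> R \<and> distinct (pawalk_verts u p)"
  using assms
proof (induction rule: converse_rtrancl_induct)
  case base
  show ?case by (intro exI[of _ "[]"]) simp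
next
  case (step a b)
  then obtain p where p: "pcas b p v" "set p \<subseteq> R" "distinct (pawalk_verts b p)" by blast
  show ?case
  proof (cases "a \<in> set (pawalk_verts b p)")
    case True
    with simple_path_suffix[OF p(1,3)] p(2) show ?thesis by blast
  next
    case False
    with p step.hyps(1) show ?thesis by (intro exI[of _ "(a, b) # p"]) simp
  qed
qed

lemma cycle_with_proj_iff:
  "pre_digraph.cycle (with_proj G) p \<longleftrightarrow>
    (\<exists>u \<in> pverts G. set p \<subseteq> parcs G \<and> pcas u p u \<and> distinct (tl (pawalk_verts u p)) \<and> p \<noteq> [])"
  by (auto simp: pre_digraph.cycle_def pre_digraph.awalk_def cas_with_proj_eq
      awalk_verts_with_proj_eq)

lemma apath_with_proj_iff:
  "pre_digraph.apath (with_proj G) u p v \<longleftrightarrow>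
    u \<in> pverts G \<and> set p \<subseteq> parcs G \<and> pcas u p v \<and> distinct (pawalk_verts u p)"
  by (auto simp: pre_digraph.apath_def pre_digraph.awalk_def cas_with_proj_eq
      awalk_verts_with_proj_eq)

lemma directed_cycle_set:
  assumes p: "pcas u p u" and "distinct (tl (pawalk_verts u p))" "p \<noteq> []"
  shows "directed_cycle (set p)"
proof -
  have heads: "distinct (map snd p)" using assms by (simp add: pawalk_verts_heads)
  have eq: "u # map snd p = map fst p @ [u]"
    using pawalk_verts_heads[OF p] pawalk_verts_tails[OF p] by simp
  \<comment> \<open>The hypothesis gives distinct heads. By \<open>eq\<close> the tails are the
    heads rotated by one place, the final head \<open>u\<close> moving to the front.\<close>
  have tails: "distinct (map fst p)"
  proof -
    have "last (map snd p) = u" using eq \<open>p \<noteq> []\<close>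
      by (metis last_ConsR last_snoc list.map_disc_iff)
    then have "map snd p = butlast (map snd p) @ [u]"
      using \<open>p \<noteq> []\<close> by (metis append_butlast_last_id list.map_disc_iff)
    moreover from this have "map fst p = u # butlast (map snd p)"
      using eq by (metis append_Cons append_same_eq)
    ultimately show ?thesis using heads
      by (metis distinct.simps(2) distinct_append not_distinct_conv_prefix distinct1_rotate rotate1.simps(2))
  qed
  have "a = b" if "(a, c) \<in> set p" "(b, c) \<in> set p" for a b c
    using heads that inj_onD[of snd "set p" "(a, c)" "(b, c)"] by (simp add: distinct_map)
  moreover have "b = c" if "(a, b) \<in> set p" "(a, c) \<in> set p" for a b c
    using tails that inj_onD[of fst "set p" "(a, b)" "(a, c)"] by (simp add: distinct_map)
  moreover have "(a, b) \<in> (set p)\<^sup>*" if "a \<in> Field (set p)" "b \<in> Field (set p)" for a b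
  proof -
    have "w \<in> set (pawalk_verts u p)" if w: "w \<in> Field (set p)" for w
    proof -
      have "w \<in> set (map fst p) \<union> set (map snd p)"
        using w by (force simp: Field_def)
      then show ?thesis
        using pawalk_verts_heads[OF p] pawalk_verts_tails[OF p] by (metis UnE Un_iff list.set_intros(2) set_append)
    qed
    with that pcas_reachable[OF p] show ?thesis by (meson rtrancl_trans)
  qed
  ultimately show ?thesis using \<open>p \<noteq> []\<close>
    by (auto simp: directed_cycle_def intro!: single_valuedI)
qed

text \<open>Membership in the field may come from an incoming arc only; but a vertex that has to
  reach the tail \<open>a\<close> of some arc is either \<open>a\<close> itself or has an arc
  out.\<close>

lemma directed_cycle_succ:
  assumes "directed_cycle C" "v \<in> Field C"
  shows "\<exists>w. (v, w) \<in> C"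
proof -
  from assms(1) obtain a b where ab: "(a, b) \<in> C" by (auto simp: directed_cycle_def)
  show ?thesis
  proof (cases "v = a")
    case False
    have "(v, a) \<in> C\<^sup>*" using assms ab by (auto simp: directed_cycle_def Field_def)
    with False show ?thesis by (meson converse_rtranclE)
  qed (use ab in blast)
qed

lemma directed_cycle_converse:
  "directed_cycle C \<Longrightarrow> directed_cycle (C\<inverse>)"
  by (auto simp: directed_cycle_def rtrancl_converse)

lemma directed_cycle_2cycle:
  assumes "directed_cycle C" "(a, b) \<in> C" "(b, a) \<in> C"
  shows "C = {(a, b), (b, a)}"
proof -
  have succ: "w = b" if "(a, w) \<in> C" for w
    using assms that by (auto simp: directed_cycle_def dest: single_valuedD)
  have succ': "w = a" if "(b, w) \<in> C" for w
    using assms that by (auto simp: directed_cycle_def dest: single_valuedD)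
  have "u \<in> {a, b}" if "u \<in> Field C" for u
  proof (rule rtrancl_closed)
    show "(a, u) \<in> C\<^sup>*" using assms that by (auto simp: directed_cycle_def Field_def)
  qed (auto dest: succ succ')
  then have "u \<in> {a, b}" if "(u, w) \<in> C" for u w using that by (meson FieldI1)
  then show ?thesis using assms(2,3) succ succ' by fast
qed

text \<open>An arc together with its reverse would already be the whole cycle, while
  \<open>p\<close> consists of at least three distinct arcs.\<close>

lemma directed_cycle_set_asym:
  assumes "pcas u p u" "distinct (tl (pawalk_verts u p))" "3 \<le> length p"
  shows "set p \<inter> (set p)\<inverse> = {}"
proof (rule ccontr)
  assume "set p \<inter> (set p)\<inverse> \<noteq> {}"
  then obtain a b where ab: "(a, b) \<in> set p" "(b, a) \<in> set p" by auto
  have "p \<noteq> []" using assms(3) by auto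
  then have "set p = {(a, b), (b, a)}"
    using directed_cycle_2cycle[OF directed_cycle_set[OF assms(1,2)] ab] by simp
  then have "card (set p) \<le> 2" by (simp add: card_insert_le_m1)
  moreover have "distinct p"
    using assms(1,2) pawalk_verts_heads[OF assms(1)] by (simp add: distinct_map)
  ultimately show False using assms(3) distinct_card by fastforce
qed

text \<open>A simple path in \<open>C\<close> from \<open>y\<close> back to \<open>x\<close>, closed
  by \<open>(x, y)\<close>, is a cycle inside \<open>C\<close>. Its vertices are closed under the
  unique successor in \<open>C\<close>, so it exhausts \<open>C\<close>.\<close>

lemma directed_cycle_list:
  assumes C: "directed_cycle C" and asym: "C \<inter> C\<inverse> = {}" and xy: "(x, y) \<in> C"
  shows "\<exists>p. pcas x p x \<and> distinct (tl (pawalk_verts x p)) \<and> 3 \<le> length p \<and> set p = C"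
proof -
  have "(y, x) \<in> C\<^sup>*" using C xy by (auto simp: directed_cycle_def Field_def)
  then obtain q where q: "pcas y q x" "set q \<subseteq> C" "distinct (pawalk_verts y q)"
    using rtrancl_simple_path by metis
  let ?p = "(x, y) # q"
  have p: "pcas x ?p x" "distinct (tl (pawalk_verts x ?p))" using q by auto
  have sub: "set ?p \<subseteq> C" using q xy by auto
  have dc: "directed_cycle (set ?p)" by (rule directed_cycle_set[OF p]) simp
  have "C \<subseteq> set ?p"
  proof (clarify)
    fix a b assume ab: "(a, b) \<in> C"
    have "a \<in> Field (set ?p)"
    proof (rule rtrancl_closed)
      show "(x, a) \<in> C\<^sup>*" using C xy ab by (auto simp: directed_cycle_def Field_def)
      show "x \<in> Field (set ?p)" by (auto simp: Field_def)
    next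
      fix u v assume "u \<in> Field (set ?p)" "(u, v) \<in> C"
      moreover from this obtain w where "(u, w) \<in> set ?p" using directed_cycle_succ[OF dc] by metis
      moreover from this have "(u, w) \<in> C" using sub by blast
      ultimately have "(u, v) \<in> set ?p" using C by (metis directed_cycle_def single_valuedD)
      then show "v \<in> Field (set ?p)" by (rule FieldI2)
    qed
    then obtain w where "(a, w) \<in> set ?p" using directed_cycle_succ[OF dc] by metis
    moreover from this have "(a, w) \<in> C" using sub by blast
    ultimately show "(a, b) \<in> set ?p" using C ab by (metis directed_cycle_def single_valuedD)
  qed
  with sub have eq: "set ?p = C" by blast
  have "3 \<le> length ?p"
  proof -
    obtain z where z: "(y, z) \<in> C" using directed_cycle_succ[OF C] xy by (meson FieldI2)
    obtain w where w: "(z, w) \<in> C" using directed_cycle_succ[OF C] z by (meson FieldI2)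
    \<comment> \<open>Asymmetry separates three consecutive tails, so the arcs are three in number
      even if \<open>w = x\<close>.\<close>
    have "x \<noteq> y" "y \<noteq> z" "z \<noteq> x" using asym xy z by auto
    then have "card {(x, y), (y, z), (z, w)} = 3" by simp
    moreover have "{(x, y), (y, z), (z, w)} \<subseteq> set ?p" using xy z w unfolding eq by blast
    ultimately show ?thesis
      by (metis List.finite_set card_length card_mono le_trans)
  qed
  with p eq show ?thesis by blast
qed

text \<open>The common arc propagates: if \<open>D\<close> traversed the next edge backwards, two
  arcs of \<open>D\<close> would enter \<open>u\<close>, and injectivity would fold \<open>C\<close>
  back onto itself. Asymmetry is asked of \<open>C\<close> alone because the competitors
  \<open>D\<close> in \<open>oriented_loop\<close> are cycles without a bound on the length.\<close>

lemma directed_cycle_orientation_unique: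
  assumes C: "directed_cycle C" and asym: "C \<inter> C\<inverse> = {}" and D: "directed_cycle D"
    and symcl: "symcl D = symcl C" and xy: "(x, y) \<in> C" "(x, y) \<in> D"
  shows "D = C"
proof -
  have step: "(u, v) \<in> D" if "(x, u) \<in> C\<^sup>*" "(u, v) \<in> C" for u v
    using that
  proof (induction arbitrary: v rule: rtrancl_induct)
    case base
    with C xy show ?case by (auto simp: directed_cycle_def dest: single_valuedD)
  next
    case (step t u)
    have tu: "(t, u) \<in> D" using step by blast
    have "(u, v) \<in> symcl D" using step.prems by (simp add: symcl mem_symcl_iff)
    moreover have False if "(v, u) \<in> D"
    proof -
      have "v = t" using that tu D by (auto simp: directed_cycle_def dest: single_valuedD)
      with step.hyps(2) step.prems asym show False by blast
    qed
    ultimately show ?case by (auto simp: mem_symcl_iff)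
  qed
  have CD: "C \<subseteq> D"
  proof clarify
    fix u v assume uv: "(u, v) \<in> C"
    then have "(x, u) \<in> C\<^sup>*" using C xy by (auto simp: directed_cycle_def Field_def)
    with uv show "(u, v) \<in> D" by (rule step[rotated])
  qed
  have "D \<subseteq> C"
  proof clarify
    fix u v assume uv: "(u, v) \<in> D"
    then have "u \<in> Field (symcl D)" unfolding Field_symcl by (rule FieldI1)
    then have "u \<in> Field C" by (simp add: symcl Field_symcl)
    then obtain w where w: "(u, w) \<in> C" using directed_cycle_succ[OF C] by metis
    with CD uv D have "w = v" by (auto simp: directed_cycle_def dest: single_valuedD)
    with w show "(u, v) \<in> C" by simp
  qed
  with CD show ?thesis by blast
qed


section \<open>Loops and their orientations\<close>

lemma (in pair_graph) converse_subset_parcs: "A \<subseteq> parcs G \<Longrightarrow> A\<inverse> \<subseteq> parcs G"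
  using arcs_symmetric by blast

lemma (in pair_graph) symcl_subset_parcs:
  assumes "A \<subseteq> parcs G"
  shows "symcl A \<subseteq> parcs G"
  using assms arcs_symmetric by (fastforce simp: symcl_def)

lemma (in pair_graph) loops_eq: "loops G = symcl ` oriented_cycles G"
proof
  show "loops G \<subseteq> symcl ` oriented_cycles G"
  proof
    fix L assume "L \<in> loops G"
    then obtain p u where "L = symcl (set p)" "set p \<subseteq> parcs G" "3 \<le> length p"
      "pcas u p u" "distinct (tl (pawalk_verts u p))" "p \<noteq> []"
      unfolding loops_def cycle_with_proj_iff by blast
    then show "L \<in> symcl ` oriented_cycles G"
      using directed_cycle_set[of u p] directed_cycle_set_asym[of u p]
      by (simp add: oriented_cycles_def)
  qed
next
  show "symcl ` oriented_cycles G \<subseteq> loops G"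
  proof
    fix L assume "L \<in> symcl ` oriented_cycles G"
    then obtain C where C: "L = symcl C" "C \<subseteq> parcs G" "directed_cycle C" "C \<inter> C\<inverse> = {}"
      by (auto simp: oriented_cycles_def)
    then obtain x y where "(x, y) \<in> C" by (auto simp: directed_cycle_def)
    with C directed_cycle_list obtain p where p: "pcas x p x" "distinct (tl (pawalk_verts x p))"
      "3 \<le> length p" "set p = C" by metis
    have "x \<in> pverts G" "p \<noteq> []" using C(2) \<open>(x, y) \<in> C\<close> p(3) by (auto dest: in_arcsD1)
    with p C have "pre_digraph.cycle (with_proj G) p" by (auto simp: cycle_with_proj_iff)
    with p C show "L \<in> loops G" by (auto simp: loops_def)
  qed
qed

lemma (in pair_graph) oriented_cycles_converse:
  "C \<in> oriented_cycles G \<Longrightarrow> C\<inverse> \<in> oriented_cycles G"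
  unfolding oriented_cycles_def
  using converse_subset_parcs[of C] directed_cycle_converse[of C] by (simp add: Int_commute)

lemma (in pair_graph) loops_through_eq:
  "loops_through G x y = symcl ` {C \<in> oriented_cycles G. (x, y) \<in> C}"
proof -
  have "symcl C \<in> symcl ` {C \<in> oriented_cycles G. (x, y) \<in> C}"
    if C: "C \<in> oriented_cycles G" "(x, y) \<in> symcl C" for C
  proof (cases "(x, y) \<in> C")
    case False
    with C have "(x, y) \<in> C\<inverse>" by (simp add: mem_symcl_iff)
    with oriented_cycles_converse[OF C(1)] show ?thesis by (metis (mono_tags, lifting) image_eqI mem_Collect_eq symcl_converse)
  qed (use C in blast)
  then show ?thesis by (auto simp: loops_through_def loops_eq mem_symcl_iff)
qed

lemma (in pair_graph) loops_through_commute: "loops_through G x y = loops_through G y x"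
  by (auto simp: loops_through_def loops_eq mem_symcl_iff)

lemma (in pair_graph) oriented_loop_symcl:
  assumes C: "C \<in> oriented_cycles G" and xy: "(x, y) \<in> C"
  shows "oriented_loop G (symcl C) x y = C"
  unfolding oriented_loop_def
proof (rule the_equality)
  have C': "C \<subseteq> parcs G" "directed_cycle C" "C \<inter> C\<inverse> = {}" using C by (auto simp: oriented_cycles_def)
  with xy directed_cycle_list obtain p where p: "pcas x p x" "distinct (tl (pawalk_verts x p))"
    "set p = C" by metis
  have "x \<in> pverts G" "p \<noteq> []" using C' xy p by (auto dest: in_arcsD1)
  with p C' xy show "(\<exists>p. cycle p \<and> C = set p) \<and> symcl C = symcl C \<and> (x, y) \<in> C"
    by (auto simp: cycle_with_proj_iff)
  fix D assume D: "(\<exists>p. cycle p \<and> D = set p) \<and> symcl D = symcl C \<and> (x, y) \<in> D"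
  then have "directed_cycle D" by (auto simp: cycle_with_proj_iff directed_cycle_set)
  moreover from D have "symcl D = symcl C" "(x, y) \<in> D" by blast+
  ultimately show "D = C" using C' xy directed_cycle_orientation_unique by metis
qed

text \<open>The function takes both arguments because hairs are attached to the undirected loop and
  the cycle weight to its orientation.\<close>

lemma (in pair_graph) sum_loops_through:
  "(\<Sum>L \<in> loops_through G x y. f L (oriented_loop G L x y))
    = (\<Sum>C \<in> {C \<in> oriented_cycles G. (x, y) \<in> C}. f (symcl C) C)"
proof -
  have "inj_on symcl {C \<in> oriented_cycles G. (x, y) \<in> C}"
  proof (rule inj_onI)
    fix C D assume "C \<in> {C \<in> oriented_cycles G. (x, y) \<in> C}"
      "D \<in> {C \<in> oriented_cycles G. (x, y) \<in> C}" "symcl C = symcl D"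
    then show "C = D" using directed_cycle_orientation_unique[of D C x y]
      by (simp add: oriented_cycles_def)
  qed
  then show ?thesis
    by (simp add: loops_through_eq sum.reindex oriented_loop_symcl)
qed


section \<open>Spanning trees as in-forests with one root\<close>

lemma connected_rtrancl_parcs:
  assumes "pair_graph G" "Digraph_Component.connected (with_proj G)" "u \<in> pverts G" "v \<in> pverts G"
  shows "(u, v) \<in> (parcs G)\<^sup>*"
proof -
  interpret pair_graph G by fact
  have "parcs (mk_symmetric (with_proj G)) = parcs G"
    using arcs_symmetric by (fastforce simp: mk_symmetric_def)
  then show ?thesis
    using assms reachable_rtranclI[of "with_proj (mk_symmetric (with_proj G))" u v]
    by (auto simp: connected_def strongly_connected_def mk_symmetric_def)
qed

lemma connectedI_rtrancl:
  assumes "pair_graph G" "pverts G \<noteq> {}"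
    and reach: "\<And>u v. u \<in> pverts G \<Longrightarrow> v \<in> pverts G \<Longrightarrow> (u, v) \<in> (parcs G)\<^sup>*"
  shows "Digraph_Component.connected (with_proj G)"
proof -
  interpret pair_graph G by fact
  have eq: "mk_symmetric (with_proj G) = G"
  proof (rule pair_pre_digraph.equality)
    show "parcs (mk_symmetric (with_proj G)) = parcs G"
      using arcs_symmetric by (fastforce simp: mk_symmetric_def)
  qed (simp_all add: mk_symmetric_def)
  have "u \<rightarrow>\<^sup>*\<^bsub>with_proj G\<^esub> v" if "u \<in> pverts G" "v \<in> pverts G" for u v
    using reach[OF that] that(1)
  proof (induction rule: rtrancl_induct)
    case (step b c)
    then show ?case by (metis reachable_adj_trans with_proj_simps(3))
  qed simp
  then show ?thesis using assms(2) by (simp add: connected_def strongly_connected_def eq)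
qed

text \<open>Both uses of the acyclicity of a tree go through this closing of a detour that avoids
  \<open>z\<close>. The ends \<open>a\<close> and \<open>b\<close> differ, so \<open>r\<close> is
  nonempty and the closed walk has at least three arcs.\<close>

lemma (in pair_graph) closed_path_loop:
  assumes za: "(z, a) \<in> parcs G" and bz: "(b, z) \<in> parcs G" and "a \<noteq> b"
    and r: "pcas a r b" "set r \<subseteq> parcs G" "distinct (pawalk_verts a r)" "z \<notin> set (pawalk_verts a r)"
  shows "loops G \<noteq> {}"
proof -
  let ?p = "(z, a) # r @ [(b, z)]"
  have "r \<noteq> []" using r(1) \<open>a \<noteq> b\<close> by auto
  then have "3 \<le> length ?p" by (cases r) auto
  have pz: "pcas a (r @ [(b, z)]) z" using r(1) by (subst pcas_append_iff) auto
  moreover have "distinct (pawalk_verts a (r @ [(b, z)]))"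
    using r pawalk_verts_heads[OF pz] pawalk_verts_heads[OF r(1)] by auto
  ultimately have "pre_digraph.cycle (with_proj G) ?p"
    using za bz r(2) unfolding cycle_with_proj_iff by (intro bexI[of _ z]) (auto dest: in_arcsD1)
  with \<open>3 \<le> length ?p\<close> show ?thesis unfolding loops_def by blast
qed

text \<open>After their first arcs both paths reach \<open>x\<close> without meeting
  \<open>z\<close>. Edges can be reversed, so \<open>a\<close> and \<open>b\<close> are joined in
  the graph with \<open>z\<close> deleted, and two distinct neighbours of \<open>z\<close> would
  close a loop.\<close>

lemma (in pair_graph) simple_path_first_step_unique:
  assumes acyc: "loops G = {}"
    and p: "set ((z, a) # p) \<subseteq> parcs G" "pcas z ((z, a) # p) x" "distinct (pawalk_verts z ((z, a) # p))"
    and q: "set ((z, b) # q) \<subseteq> parcs G" "pcas z ((z, b) # q) x" "distinct (pawalk_verts z ((z, b) # q))"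
  shows "a = b"
proof (rule ccontr)
  assume "a \<noteq> b"
  define R where "R = {(c, d) \<in> parcs G. c \<noteq> z \<and> d \<noteq> z}"
  have avoid: "(c, x) \<in> R\<^sup>*" if s: "set s \<subseteq> parcs G" "pcas c s x" "z \<notin> set (pawalk_verts c s)" for c s
  proof -
    have "u \<noteq> z \<and> v \<noteq> z" if "(u, v) \<in> set s" for u v
      using that s(3) pawalk_verts_heads[OF s(2)] pawalk_verts_tails[OF s(2)]
      by (metis (no_types, lifting) Un_iff fst_conv image_eqI list.set_intros(2) list.set_map set_append snd_conv)
    then have "set s \<subseteq> R" using s(1) by (auto simp: R_def)
    moreover have "(c, x) \<in> (set s)\<^sup>*"
      using pcas_reachable[OF s(2)] pawalk_verts_heads[OF s(2)] by simp
    ultimately show ?thesis using rtrancl_mono by blast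
  qed
  have "sym R" by (auto simp: R_def intro!: symI dest: arcs_symmetric)
  then have "sym (R\<^sup>*)" by (rule sym_rtrancl)
  moreover have "(a, x) \<in> R\<^sup>*" "(b, x) \<in> R\<^sup>*"
    using p q avoid[of p a] avoid[of q b] by auto
  ultimately have "(a, b) \<in> R\<^sup>*" by (meson rtrancl_trans symD)
  then obtain r where r: "pcas a r b" "set r \<subseteq> R" "distinct (pawalk_verts a r)"
    using rtrancl_simple_path by metis
  have "a \<noteq> z" using p(3) pawalk_verts_heads[of a p x] p(2) by auto
  moreover have "z \<notin> snd ` set r" using r(2) by (auto simp: R_def)
  ultimately have "z \<notin> set (pawalk_verts a r)" by (simp add: pawalk_verts_heads[OF r(1)])
  moreover have "(b, z) \<in> parcs G" using q(1) arcs_symmetric by simp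
  moreover have "set r \<subseteq> parcs G" using r(2) by (auto simp: R_def)
  ultimately have "loops G \<noteq> {}" using p(1) r \<open>a \<noteq> b\<close> closed_path_loop by auto
  with acyc show False by contradiction
qed

lemma in_tree_iff:
  "(z, z') \<in> in_tree T x \<longleftrightarrow> z \<in> pverts T \<and> (\<exists>p. set ((z, z') # p) \<subseteq> parcs T
    \<and> pcas z ((z, z') # p) x \<and> distinct (pawalk_verts z ((z, z') # p)))"
  by (auto simp: in_tree_def apath_with_proj_iff)

text \<open>Every suffix of a simple path is simple and ends at the same vertex, so each of its arcs
  is the first arc of such a path.\<close>

lemma simple_path_subset_in_tree:
  assumes "set p \<subseteq> parcs T" "pcas z p x" "distinct (pawalk_verts z p)" "pair_graph T"
  shows "set p \<subseteq> in_tree T x"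
  using assms(1-3)
proof (induction p arbitrary: z)
  case (Cons e p)
  interpret pair_graph T by fact
  have e: "e = (z, snd e)" using Cons.prems by (auto simp: prod_eq_iff)
  have "z \<in> pverts T" using Cons.prems e by (metis in_arcsD1 list.set_intros(1) subsetD)
  with e Cons.prems have "e \<in> in_tree T x" by (metis in_tree_iff)
  moreover have "set p \<subseteq> in_tree T x" using Cons.prems by (intro Cons.IH[of "snd e"]) auto
  ultimately show ?case by simp
qed simp

lemma spanning_treesD:
  assumes "T \<in> spanning_trees G"
  shows "pair_graph T" "pverts T = pverts G" "parcs T \<subseteq> parcs G"
    "Digraph_Component.connected (with_proj T)" "loops T = {}"
  using assms by (auto simp: spanning_trees_def spanning_def subgraph_def)

lemma in_tree_in_forests:
  assumes T: "T \<in> spanning_trees G" and x: "x \<in> pverts G"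
  shows "in_tree T x \<in> in_forests G {x}"
proof -
  note T' = spanning_treesD[OF T]
  interpret T: pair_graph T by (rule T')
  have path: "\<exists>p. set p \<subseteq> parcs T \<and> pcas z p x \<and> distinct (pawalk_verts z p)" if "z \<in> pverts G" for z
    using rtrancl_simple_path[OF connected_rtrancl_parcs[OF T'(1,4), of z x]] that x T'(2) by auto
  have "\<exists>!z'. (z, z') \<in> in_tree T x" if z: "z \<in> pverts G - {x}" for z
  proof -
    obtain p where p: "set p \<subseteq> parcs T" "pcas z p x" "distinct (pawalk_verts z p)" using path z by blast
    with z obtain e p' where e: "p = e # p'" by (cases p) auto
    with p have "e = (z, snd e)" by (auto simp: prod_eq_iff)
    with e simple_path_subset_in_tree[OF p T'(1)] have "(z, snd e) \<in> in_tree T x" by auto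
    moreover have "a = b" if "(z, a) \<in> in_tree T x" "(z, b) \<in> in_tree T x" for a b
      using that T'(5) unfolding in_tree_iff by (blast intro: T.simple_path_first_step_unique)
    ultimately show ?thesis by blast
  qed
  moreover have "(z, x) \<in> (in_tree T x)\<^sup>*" if z: "z \<in> pverts G" for z
  proof -
    obtain p where p: "set p \<subseteq> parcs T" "pcas z p x" "distinct (pawalk_verts z p)" using path z by blast
    then have "(z, x) \<in> (set p)\<^sup>*" using pcas_reachable[OF p(2)] pawalk_verts_heads[OF p(2)] by simp
    moreover have "(set p)\<^sup>* \<subseteq> (in_tree T x)\<^sup>*"
      using p T' by (intro rtrancl_mono simple_path_subset_in_tree)
    ultimately show ?thesis by blast
  qed
  moreover have "(x, z') \<notin> in_tree T x" for z'
  proof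
    assume "(x, z') \<in> in_tree T x"
    then obtain p where "pcas x ((x, z') # p) x" "distinct (pawalk_verts x ((x, z') # p))"
      unfolding in_tree_iff by blast
    then show False using pawalk_verts_tails[of z' p x] by auto
  qed
  moreover have "in_tree T x \<subseteq> parcs G" using T'(3) by (auto simp: in_tree_iff)
  ultimately show ?thesis by (simp add: in_forests_def)
qed

text \<open>Passing to the in-tree loses no edge. The simple path from \<open>b\<close> to
  \<open>x\<close> either misses \<open>a\<close>, and then \<open>(a, b)\<close> can be put in
  front of it, or it meets \<open>a\<close>, and then \<open>(b, a)\<close> must be its first
  arc.\<close>

lemma symcl_in_tree:
  assumes T: "T \<in> spanning_trees G" and x: "x \<in> pverts G"
  shows "symcl (in_tree T x) = parcs T"
proof
  note T' = spanning_treesD[OF T]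
  interpret T: pair_graph T by (rule T')
  show "symcl (in_tree T x) \<subseteq> parcs T" by (rule T.symcl_subset_parcs) (auto simp: in_tree_iff)
  show "parcs T \<subseteq> symcl (in_tree T x)"
  proof clarify
    fix a b assume ab: "(a, b) \<in> parcs T"
    have "b \<in> pverts T" using ab by (rule T.in_arcsD2)
    then obtain p where p: "set p \<subseteq> parcs T" "pcas b p x" "distinct (pawalk_verts b p)"
      using rtrancl_simple_path[OF connected_rtrancl_parcs[OF T'(1,4), of b x]] x T'(2) by auto
    show "(a, b) \<in> symcl (in_tree T x)"
    proof (cases "a \<in> set (pawalk_verts b p)")
      case False
      with ab p have "set ((a, b) # p) \<subseteq> in_tree T x"
        by (intro simple_path_subset_in_tree[where z = a] T') auto
      then show ?thesis by (simp add: mem_symcl_iff)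
    next
      case True
      have "a \<noteq> b" using ab by (rule T.no_loops')
      with True p obtain c p' where p': "p = (b, c) # p'" by (cases p) (auto simp: prod_eq_iff)
      \<comment> \<open>Otherwise the part of the path from \<open>c\<close> to \<open>a\<close>
        avoids \<open>b\<close>, and the edges from \<open>b\<close> to its ends close a
        loop.\<close>
      have "c = a"
      proof (rule ccontr)
        assume "c \<noteq> a"
        have "(c, a) \<in> (set p')\<^sup>*"
          using pcas_reachable[of c p' x a] p p' True \<open>a \<noteq> b\<close> by auto
        then obtain r where r: "pcas c r a" "set r \<subseteq> set p'" "distinct (pawalk_verts c r)"
          using rtrancl_simple_path by metis
        have "b \<noteq> c" "b \<notin> snd ` set p'"
          using p p' pawalk_verts_heads[of c p' x] by auto
        with r have "b \<notin> set (pawalk_verts c r)"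
          by (auto simp: pawalk_verts_heads[OF r(1)])
        then have "loops T \<noteq> {}"
          using T.closed_path_loop[of b c a r] p p' ab r \<open>c \<noteq> a\<close> by auto
        with T'(5) show False by contradiction
      qed
      with p' simple_path_subset_in_tree[OF p T'(1)] show ?thesis by (simp add: mem_symcl_iff)
    qed
  qed
qed

section \<open>In-forests and the tree bijection\<close>

lemma in_forestsD:
  assumes "A \<in> in_forests G R"
  shows "A \<subseteq> parcs G" "\<And>z z'. z \<in> R \<Longrightarrow> (z, z') \<notin> A"
    "\<And>z. z \<in> pverts G - R \<Longrightarrow> \<exists>!z'. (z, z') \<in> A"
    "\<And>z. z \<in> pverts G - R \<Longrightarrow> \<exists>v \<in> R. (z, v) \<in> A\<^sup>*"
  using assms by (auto simp: in_forests_def)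

context pair_graph
begin

lemma in_forests_tail:
  assumes "A \<in> in_forests G R" "(a, b) \<in> A"
  shows "a \<in> pverts G - R"
  using in_forestsD(1,2)[OF assms(1)] assms(2) by (auto dest: in_arcsD1)

lemma in_forests_single_valued:
  assumes "A \<in> in_forests G R"
  shows "single_valued A"
  using in_forestsD(3)[OF assms] in_forests_tail[OF assms] by (metis single_valuedI)

text \<open>A vertex on a cycle would reach a root, and determinism would force the root to lead
  back; but no arc leaves a root.\<close>

lemma in_forests_acyclic:
  assumes A: "A \<in> in_forests G R"
  shows "acyclic A"
proof (rule acyclicI, rule allI, rule notI)
  fix v assume cyc: "(v, v) \<in> A\<^sup>+"
  then obtain w where "(v, w) \<in> A" by (meson tranclD)
  then obtain r where r: "r \<in> R" "(v, r) \<in> A\<^sup>*"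
    using in_forestsD(4)[OF A] in_forests_tail[OF A] by blast
  then have "(r, v) \<in> A\<^sup>+"
    using single_valued_cycle_back[OF in_forests_single_valued[OF A] cyc] by blast
  then show False using in_forestsD(2)[OF A r(1)] by (meson tranclD)
qed

lemma finite_in_forests: "finite (in_forests G R)"
  by (rule finite_subset[of _ "Pow (parcs G)"]) (auto simp: in_forests_def pair_finite_arcs)

lemma in_forest_reaches_root:
  assumes "A \<in> in_forests G {x}" "z \<in> pverts G"
  shows "(z, x) \<in> A\<^sup>*"
  using in_forestsD(4)[OF assms(1), of z] assms(2) by (cases "z = x") auto

lemma pair_graph_symcl:
  assumes "A \<subseteq> parcs G"
  shows "pair_graph \<lparr>pverts = pverts G, parcs = symcl A\<rparr>"
proof -
  have sub: "symcl A \<subseteq> parcs G" by (rule symcl_subset_parcs) fact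
  show ?thesis
  proof unfold_locales
    show "finite (parcs \<lparr>pverts = pverts G, parcs = symcl A\<rparr>)"
      using sub pair_finite_arcs by (simp add: finite_subset)
    show "symmetric (with_proj \<lparr>pverts = pverts G, parcs = symcl A\<rparr>)"
      by (auto simp: symmetric_def mem_symcl_iff intro!: symI)
  qed (auto dest!: subsetD[OF sub] dest: in_arcsD1 in_arcsD2 no_loops' simp: pair_finite_verts)
qed

lemma in_forest_spanning_tree:
  assumes A: "A \<in> in_forests G {x}" and x: "x \<in> pverts G"
  shows "\<lparr>pverts = pverts G, parcs = symcl A\<rparr> \<in> spanning_trees G"
proof -
  let ?T = "\<lparr>pverts = pverts G, parcs = symcl A\<rparr>"
  note A' = in_forestsD[OF A]
  have T: "pair_graph ?T" by (rule pair_graph_symcl) fact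
  interpret T: pair_graph ?T by fact
  have "spanning (with_proj ?T) (with_proj G)"
    using symcl_subset_parcs[OF A'(1)] T.wf_digraph wf_digraph
    by (auto simp: spanning_def subgraph_def)
  moreover have "Digraph_Component.connected (with_proj ?T)"
  proof (rule connectedI_rtrancl[OF T])
    fix u v assume "u \<in> pverts ?T" "v \<in> pverts ?T"
    then have "(u, x) \<in> A\<^sup>*" "(x, v) \<in> (A\<inverse>)\<^sup>*"
      using in_forest_reaches_root[OF A] by (auto simp: rtrancl_converse)
    moreover have "A\<^sup>* \<subseteq> (symcl A)\<^sup>*" "(A\<inverse>)\<^sup>* \<subseteq> (symcl A)\<^sup>*"
      by (intro rtrancl_mono; auto simp: symcl_def)+
    ultimately show "(u, v) \<in> (parcs ?T)\<^sup>*" by (auto intro: rtrancl_trans)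
  qed (use x in auto)
  moreover have False if "C \<in> oriented_cycles ?T" for C
  proof -
    from that have C: "C \<subseteq> symcl A" "directed_cycle C" "C \<inter> C\<inverse> = {}"
      by (auto simp: oriented_cycles_def)
    \<comment> \<open>Choose on the supposed cycle \<open>C\<close> a vertex \<open>v\<close> that
      no arc of \<open>A\<close> enters from \<open>C\<close>. Both edges of \<open>C\<close> at
      \<open>v\<close> then come from arcs of \<open>A\<close> out of \<open>v\<close>; there is
      only one such arc, so the two neighbours coincide, against the asymmetry of
      \<open>C\<close>.\<close>
    have "wf A"
      using A'(1) pair_finite_arcs by (intro finite_acyclic_wf in_forests_acyclic[OF A]) (rule finite_subset)
    moreover have "Field C \<noteq> {}" using C(2) by (auto simp: directed_cycle_def Field_def)
    ultimately obtain v where v: "v \<in> Field C" "\<And>u. (u, v) \<in> A \<Longrightarrow> u \<notin> Field C"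
      by (meson ex_in_conv wfE_min)
    obtain a where a: "(v, a) \<in> C" using directed_cycle_succ[OF C(2) v(1)] by blast
    obtain b where b: "(b, v) \<in> C"
      using directed_cycle_succ[OF directed_cycle_converse[OF C(2)], of v] v(1) by auto
    have "a \<in> Field C" "b \<in> Field C" using a b by (auto simp: Field_def)
    moreover have "(v, a) \<in> symcl A" "(b, v) \<in> symcl A" using a b C(1) by blast+
    ultimately have "(v, a) \<in> A" "(v, b) \<in> A" using v(2) by (auto simp: mem_symcl_iff)
    then have "a = b" using in_forests_single_valued[OF A] by (auto dest: single_valuedD)
    with a b C(3) show False by auto
  qed
  then have "loops ?T = {}" by (auto simp: T.loops_eq)
  ultimately show ?thesis using T by (simp add: spanning_trees_def)
qed

text \<open>Following \<open>A\<close> gives a path that acyclicity keeps simple, hence one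
  inclusion. Equality follows since both sides have exactly one arc out of each vertex other than
  \<open>x\<close>.\<close>

lemma in_tree_symcl:
  assumes A: "A \<in> in_forests G {x}" and x: "x \<in> pverts G"
  shows "in_tree \<lparr>pverts = pverts G, parcs = symcl A\<rparr> x = A"
proof
  let ?T = "\<lparr>pverts = pverts G, parcs = symcl A\<rparr>"
  note A' = in_forestsD[OF A]
  have tree: "in_tree ?T x \<in> in_forests G {x}"
    using in_forest_spanning_tree[OF assms] x by (rule in_tree_in_forests)
  show sub: "A \<subseteq> in_tree ?T x"
  proof clarify
    fix z z' assume zz': "(z, z') \<in> A"
    then have "(z', x) \<in> A\<^sup>*" using A'(1) in_forest_reaches_root[OF A] by (auto dest: in_arcsD2)
    then obtain p where p: "pcas z' p x" "set p \<subseteq> A" "distinct (pawalk_verts z' p)"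
      using rtrancl_simple_path by metis
    have "z \<notin> set (pawalk_verts z' p)"
    proof
      assume "z \<in> set (pawalk_verts z' p)"
      then have "(z', z) \<in> A\<^sup>*" using pcas_reachable[OF p(1)] rtrancl_mono[OF p(2)] by blast
      with zz' have "(z, z) \<in> A\<^sup>+" by (rule rtrancl_into_trancl2)
      with in_forests_acyclic[OF A] show False by (simp add: acyclic_def)
    qed
    moreover have "A \<subseteq> symcl A" by (auto simp: symcl_def)
    ultimately have "set ((z, z') # p) \<subseteq> in_tree ?T x"
      using p zz' by (intro simple_path_subset_in_tree[of _ _ z] pair_graph_symcl A') auto
    then show "(z, z') \<in> in_tree ?T x" by simp
  qed
  show "in_tree ?T x \<subseteq> A"
  proof clarify
    fix z w assume zw: "(z, w) \<in> in_tree ?T x"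
    then obtain w' where w': "(z, w') \<in> A" using A'(3) in_forests_tail[OF tree] by blast
    with sub zw have "w' = w" using in_forests_single_valued[OF tree] by (auto dest: single_valuedD)
    with w' show "(z, w) \<in> A" by simp
  qed
qed

lemma bij_betw_in_tree:
  assumes "x \<in> pverts G"
  shows "bij_betw (\<lambda>T. in_tree T x) (spanning_trees G) (in_forests G {x})"
proof (rule bij_betw_byWitness)
  show "\<forall>T \<in> spanning_trees G. \<lparr>pverts = pverts G, parcs = symcl (in_tree T x)\<rparr> = T"
    using assms by (auto simp: symcl_in_tree spanning_treesD(2))
qed (use assms in \<open>auto simp: in_tree_symcl in_tree_in_forests in_forest_spanning_tree\<close>)

lemma in_forests_nonempty:
  assumes conn: "Digraph_Component.connected (with_proj G)" and x: "x \<in> pverts G"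
  shows "in_forests G {x} \<noteq> {}"
proof -
  \<comment> \<open>The distance to \<open>x\<close>: sending each vertex to a neighbour at smaller
    distance builds a tree, as in breadth-first search.\<close>
  define d where "d z = (LEAST n. (z, x) \<in> parcs G ^^ n)" for z
  have "\<exists>z'. (z, z') \<in> parcs G \<and> d z' < d z" if z: "z \<in> pverts G - {x}" for z
  proof -
    have "\<exists>n. (z, x) \<in> parcs G ^^ n"
      using connected_rtrancl_parcs[OF _ conn, of z x] z x pair_graph by (auto simp: rtrancl_power)
    then have dz: "(z, x) \<in> parcs G ^^ d z" unfolding d_def by (rule LeastI_ex)
    with z obtain m where m: "d z = Suc m" by (cases "d z") auto
    with dz obtain z' where z': "(z, z') \<in> parcs G" "(z', x) \<in> parcs G ^^ m"
      by (metis relpow_Suc_E2)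
    then have "d z' \<le> m" unfolding d_def by (intro Least_le)
    with m z' show ?thesis by auto
  qed
  then obtain f where f: "\<And>z. z \<in> pverts G - {x} \<Longrightarrow> (z, f z) \<in> parcs G \<and> d (f z) < d z"
    by metis
  define A where "A = {(z, f z) | z. z \<in> pverts G - {x}}"
  have "(z, x) \<in> A\<^sup>*" if "z \<in> pverts G" for z
    using that
  proof (induction "d z" arbitrary: z rule: less_induct)
    case less
    show ?case
    proof (cases "z = x")
      case False
      with less.prems f[of z] have "(f z, x) \<in> A\<^sup>*" by (intro less.hyps) (auto dest: in_arcsD2)
      moreover have "(z, f z) \<in> A" using less.prems False by (auto simp: A_def)
      ultimately show ?thesis by (rule converse_rtrancl_into_rtrancl[rotated])
    qed simp
  qed
  then have "A \<in> in_forests G {x}" using f by (auto simp: in_forests_def A_def)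
  then show ?thesis by blast
qed

end

section \<open>The stationary distribution\<close>

definition tree_weight :: "'a pair_pre_digraph \<Rightarrow> ('a \<Rightarrow> 'a \<Rightarrow> real) \<Rightarrow> 'a \<Rightarrow> real" where
  "tree_weight G k x = (\<Sum>A \<in> in_forests G {x}. weight k A)"

text \<open>Double counting, used both for the arc out of \<open>x\<close> and for the arc of the
  cycle into \<open>x\<close>.\<close>

lemma sum_sum_ex1:
  fixes f :: "'b \<Rightarrow> 'c::comm_monoid_add"
  assumes "finite V" "finite S" and ex1: "\<And>B. B \<in> S \<Longrightarrow> \<exists>!y. y \<in> V \<and> P B y"
  shows "(\<Sum>y \<in> V. \<Sum>B \<in> {B \<in> S. P B y}. f B) = (\<Sum>B \<in> S. f B)"
proof -
  have "(\<Sum>y \<in> V. \<Sum>B \<in> {B \<in> S. P B y}. f B) = (\<Sum>B \<in> S. \<Sum>y \<in> {y \<in> V. P B y}. f B)"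
    using assms(1,2) by (rule sum.swap_restrict)
  also have "\<dots> = (\<Sum>B \<in> S. f B)"
  proof (rule sum.cong)
    fix B assume "B \<in> S"
    then obtain y where "{y \<in> V. P B y} = {y}" using ex1 by blast
    then show "(\<Sum>y \<in> {y \<in> V. P B y}. f B) = f B" by simp
  qed simp
  finally show ?thesis .
qed

lemma unicyclicD:
  assumes "B \<in> unicyclic G x"
  shows "B \<subseteq> parcs G" "\<And>z. z \<in> pverts G \<Longrightarrow> \<exists>!z'. (z, z') \<in> B"
    "\<And>z. z \<in> pverts G \<Longrightarrow> (z, x) \<in> B\<^sup>*"
  using assms by (auto simp: unicyclic_def)

context pair_graph
begin

lemma normalization_eq: "normalization G k = (\<Sum>x \<in> pverts G. tree_weight G k x)"
  unfolding normalization_def tree_weight_def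
  by (intro sum.cong refl sum.reindex_bij_betw bij_betw_in_tree)

lemma tree_weight_pos:
  assumes "Digraph_Component.connected (with_proj G)" "jump_rates G k" "x \<in> pverts G"
  shows "tree_weight G k x > 0"
  unfolding tree_weight_def
proof (rule sum_pos)
  fix A assume "A \<in> in_forests G {x}"
  then have "k a b > 0" if "(a, b) \<in> A" for a b
    using that assms(2) in_forestsD(1) in_arcsD1 in_arcsD2 unfolding jump_rates_def by (metis subsetD)
  then show "weight k A > 0" unfolding weight_def by (auto intro!: prod_pos)
qed (simp_all add: finite_in_forests in_forests_nonempty assms)

lemma finite_unicyclic: "finite (unicyclic G x)"
  by (rule finite_subset[of _ "Pow (parcs G)"]) (auto simp: unicyclic_def pair_finite_arcs)

lemma unicyclic_single_valued:
  assumes "B \<in> unicyclic G x"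
  shows "single_valued B"
  using unicyclicD(1,2)[OF assms] by (metis in_arcsD1 single_valuedI subsetD)

lemma insert_in_forest_unicyclic:
  assumes A: "A \<in> in_forests G {x}" and xy: "(x, y) \<in> parcs G"
  shows "insert (x, y) A \<in> unicyclic G x"
proof -
  have "(z, x) \<in> (insert (x, y) A)\<^sup>*" if "z \<in> pverts G" for z
    using in_forest_reaches_root[OF A that] rtrancl_mono[of A "insert (x, y) A"] by blast
  moreover have "\<exists>!z'. (z, z') \<in> insert (x, y) A" if "z \<in> pverts G" for z
    using in_forestsD(2,3)[OF A] that by (cases "z = x") auto
  ultimately show ?thesis using in_forestsD(1)[OF A] xy by (simp add: unicyclic_def)
qed

text \<open>The deleted arc is the only one out of \<open>x\<close>, so paths cut at their first
  visit to \<open>x\<close> survive.\<close>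

lemma unicyclic_remove_in_forest:
  assumes B: "B \<in> unicyclic G x" and xy: "(x, y) \<in> B"
  shows "B - {(x, y)} \<in> in_forests G {x}"
proof -
  have eq: "B - {(x, y)} = B - {x} \<times> UNIV"
    using unicyclic_single_valued[OF B] xy by (auto dest: single_valuedD)
  have "(z, x) \<in> (B - {x} \<times> UNIV)\<^sup>*" if "z \<in> pverts G" for z
    using rtrancl_first_hit[OF unicyclicD(3)[OF B that], of "{x}"] by simp
  moreover have "\<exists>!z'. (z, z') \<in> B - {x} \<times> UNIV" if "z \<in> pverts G - {x}" for z
    using unicyclicD(2)[OF B, of z] that by auto
  ultimately show ?thesis unfolding eq using unicyclicD(1)[OF B] by (auto simp: in_forests_def)
qed

lemma tree_weight_times_rate:
  assumes k: "jump_rates G k" and x: "x \<in> pverts G" and y: "y \<in> pverts G"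
  shows "tree_weight G k x * k x y = (\<Sum>B \<in> {B \<in> unicyclic G x. (x, y) \<in> B}. weight k B)"
proof (cases "(x, y) \<in> parcs G")
  case True
  have "(\<Sum>B \<in> {B \<in> unicyclic G x. (x, y) \<in> B}. weight k B)
    = (\<Sum>A \<in> in_forests G {x}. weight k A * k x y)"
  proof (rule sum.reindex_bij_witness[of _ "insert (x, y)" "\<lambda>B. B - {(x, y)}"])
    fix B assume "B \<in> {B \<in> unicyclic G x. (x, y) \<in> B}"
    then have B: "B \<in> unicyclic G x" "(x, y) \<in> B" by auto
    show "insert (x, y) (B - {(x, y)}) = B" "B - {(x, y)} \<in> in_forests G {x}"
      using B unicyclic_remove_in_forest by auto
    have "finite B" using unicyclicD(1)[OF B(1)] pair_finite_arcs by (rule finite_subset)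
    then show "weight k (B - {(x, y)}) * k x y = weight k B"
      using weight_insert[of "B - {(x, y)}" x y k] B(2) by (simp add: insert_absorb)
  next
    fix A assume A: "A \<in> in_forests G {x}"
    show "insert (x, y) A - {(x, y)} = A" using in_forestsD(2)[OF A] by auto
    show "insert (x, y) A \<in> {B \<in> unicyclic G x. (x, y) \<in> B}"
      using insert_in_forest_unicyclic[OF A True] by simp
  qed
  then show ?thesis by (simp add: tree_weight_def sum_distrib_right)
next
  \<comment> \<open>Both sides vanish for a non-edge, which lets the balance sums run over all
    vertices.\<close>
  case False
  then have "{B \<in> unicyclic G x. (x, y) \<in> B} = {}" by (auto dest: unicyclicD(1))
  with False k x y show ?thesis by (simp only: jump_rates_def) simp
qed

text \<open>\<open>(x, y) \<in> B\<^sup>*\<close> says that the arc \<open>(y, x)\<close> lies on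
  the cycle and is not a hair ending at \<open>x\<close>; then \<open>x\<close> and \<open>y\<close>
  mark the same cycle.\<close>

lemma unicyclic_shift:
  assumes "(y, x) \<in> B"
  shows "B \<in> unicyclic G y \<longleftrightarrow> B \<in> unicyclic G x \<and> (x, y) \<in> B\<^sup>*"
proof
  assume B: "B \<in> unicyclic G y"
  then have "x \<in> pverts G" using unicyclicD(1)[OF B] assms by (auto dest: in_arcsD2)
  with B assms show "B \<in> unicyclic G x \<and> (x, y) \<in> B\<^sup>*"
    by (auto simp: unicyclic_def intro: rtrancl_into_rtrancl)
next
  assume "B \<in> unicyclic G x \<and> (x, y) \<in> B\<^sup>*"
  then show "B \<in> unicyclic G y" by (auto simp: unicyclic_def intro: rtrancl_trans)
qed

lemma unicyclic_pred_ex1: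
  assumes B: "B \<in> unicyclic G x" and x: "x \<in> pverts G"
  shows "\<exists>!y. y \<in> pverts G \<and> (y, x) \<in> B \<and> (x, y) \<in> B\<^sup>*"
proof -
  obtain z where z: "(x, z) \<in> B" using unicyclicD(2)[OF B x] by blast
  then have "z \<in> pverts G" using unicyclicD(1)[OF B] by (auto dest: in_arcsD2)
  then have "(x, x) \<in> B\<^sup>+" using z unicyclicD(3)[OF B] by (auto intro: rtrancl_into_trancl2)
  then obtain y where "(x, y) \<in> B\<^sup>*" "(y, x) \<in> B" by (meson tranclD2)
  moreover have "a = b" if "(a, x) \<in> B" "(x, a) \<in> B\<^sup>*" "(b, x) \<in> B" "(x, b) \<in> B\<^sup>*" for a b
    using single_valued_cycle_pred_unique[OF unicyclic_single_valued[OF B]] that by blast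
  ultimately show ?thesis using unicyclicD(1)[OF B] by (metis in_arcsD1 subsetD)
qed

lemma tree_weight_stationary:
  assumes k: "jump_rates G k" and x: "x \<in> pverts G"
  shows "(\<Sum>y \<in> pverts G. k x y * tree_weight G k x - k y x * tree_weight G k y) = 0"
proof -
  have "(\<Sum>y \<in> pverts G. k x y * tree_weight G k x)
    = (\<Sum>y \<in> pverts G. \<Sum>B \<in> {B \<in> unicyclic G x. (x, y) \<in> B}. weight k B)"
    using tree_weight_times_rate[OF k x] by (intro sum.cong) (simp_all add: mult.commute)
  also have "\<dots> = (\<Sum>B \<in> unicyclic G x. weight k B)"
  proof (intro sum_sum_ex1)
    fix B assume B: "B \<in> unicyclic G x"
    show "\<exists>!y. y \<in> pverts G \<and> (x, y) \<in> B"
      using unicyclicD(1,2)[OF B] x by (metis in_arcsD2 subsetD)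
  qed (simp_all add: pair_finite_verts finite_unicyclic)
  finally have out: "(\<Sum>y \<in> pverts G. k x y * tree_weight G k x) = (\<Sum>B \<in> unicyclic G x. weight k B)" .
  have "(\<Sum>y \<in> pverts G. k y x * tree_weight G k y)
    = (\<Sum>y \<in> pverts G. \<Sum>B \<in> {B \<in> unicyclic G x. (y, x) \<in> B \<and> (x, y) \<in> B\<^sup>*}. weight k B)"
  proof (rule sum.cong)
    fix y assume y: "y \<in> pverts G"
    have "{B \<in> unicyclic G y. (y, x) \<in> B} = {B \<in> unicyclic G x. (y, x) \<in> B \<and> (x, y) \<in> B\<^sup>*}"
      using unicyclic_shift by blast
    then show "k y x * tree_weight G k y
      = (\<Sum>B \<in> {B \<in> unicyclic G x. (y, x) \<in> B \<and> (x, y) \<in> B\<^sup>*}. weight k B)"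
      using tree_weight_times_rate[OF k y x] by (simp add: mult.commute)
  qed simp
  also have "\<dots> = (\<Sum>B \<in> unicyclic G x. weight k B)"
    by (intro sum_sum_ex1 unicyclic_pred_ex1 x) (simp_all add: pair_finite_verts finite_unicyclic)
  finally show ?thesis using out by (simp add: sum_subtractf)
qed

section \<open>Uniqueness of the stationary distribution\<close>

text \<open>Minimum principle: at a zero the outflow vanishes, so the balance makes every
  nonnegative inflow term vanish. Positive rates carry the zero to the neighbours, and connectedness
  to all vertices.\<close>

lemma stationary_zero:
  assumes conn: "Digraph_Component.connected (with_proj G)" and k: "jump_rates G k"
    and nonneg: "\<And>x. x \<in> pverts G \<Longrightarrow> 0 \<le> f x"
    and stat: "\<And>x. x \<in> pverts G \<Longrightarrow> (\<Sum>y \<in> pverts G. k x y * f x - k y x * f y) = 0"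
    and zero: "a \<in> pverts G" "f a = 0" and z: "z \<in> pverts G"
  shows "f z = 0"
proof -
  have k_nonneg: "0 \<le> k u v" if "u \<in> pverts G" "v \<in> pverts G" for u v
    using k that unfolding jump_rates_def by (metis less_eq_real_def)
  have "(z, a) \<in> (parcs G)\<^sup>*" using connected_rtrancl_parcs[OF pair_graph conn z zero(1)] .
  then show ?thesis
  proof (induction rule: converse_rtrancl_induct)
    case (step u v)
    have u: "u \<in> pverts G" and v: "v \<in> pverts G"
      using step.hyps(1) by (auto dest: in_arcsD1 in_arcsD2)
    have "(\<Sum>y \<in> pverts G. k y v * f y) = 0"
      using stat[OF v] step.IH by (simp add: sum_negf)
    moreover have "0 \<le> k y v * f y" if "y \<in> pverts G" for y
      using that v nonneg k_nonneg by simp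
    ultimately have "k u v * f u = 0"
      using u sum_nonneg_eq_0_iff[OF pair_finite_verts, of "\<lambda>y. k y v * f y"] by auto
    moreover have "k u v > 0" using k u v step.hyps(1) by (simp add: jump_rates_def)
    ultimately show ?case by simp
  qed (rule zero)
qed

lemma stationary_proportional:
  assumes conn: "Digraph_Component.connected (with_proj G)" and k: "jump_rates G k"
    and stat: "\<And>x. x \<in> pverts G \<Longrightarrow> (\<Sum>y \<in> pverts G. k x y * \<rho> x - k y x * \<rho> y) = 0"
  shows "\<exists>c. \<forall>x \<in> pverts G. \<rho> x = c * tree_weight G k x"
proof (cases "pverts G = {}")
  case False
  let ?\<tau> = "tree_weight G k"
  \<comment> \<open>The largest multiple of the tree weights that stays below \<open>\<rho>\<close>.
    The difference is nonnegative, stationary and zero where the minimum is attained.\<close>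
  define c where "c = Min ((\<lambda>x. \<rho> x / ?\<tau> x) ` pverts G)"
  have "c \<in> (\<lambda>x. \<rho> x / ?\<tau> x) ` pverts G"
    unfolding c_def using False by (intro Min_in) (auto simp: pair_finite_verts)
  then obtain a where a: "a \<in> pverts G" "c = \<rho> a / ?\<tau> a" by blast
  have pos: "?\<tau> x > 0" if "x \<in> pverts G" for x using tree_weight_pos[OF conn k that] .
  define f where "f x = \<rho> x - c * ?\<tau> x" for x
  have "f z = 0" if "z \<in> pverts G" for z
  proof (rule stationary_zero[OF conn k])
    fix x assume x: "x \<in> pverts G"
    have "c \<le> \<rho> x / ?\<tau> x" unfolding c_def using x by (intro Min_le) (auto simp: pair_finite_verts)
    with pos[OF x] show "0 \<le> f x" by (simp add: f_def field_simps)
    have "(\<Sum>y \<in> pverts G. k x y * f x - k y x * f y)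
      = (\<Sum>y \<in> pverts G. (k x y * \<rho> x - k y x * \<rho> y) - c * (k x y * ?\<tau> x - k y x * ?\<tau> y))"
      by (simp add: f_def algebra_simps)
    also have "\<dots> = (\<Sum>y \<in> pverts G. k x y * \<rho> x - k y x * \<rho> y)
      - c * (\<Sum>y \<in> pverts G. k x y * ?\<tau> x - k y x * ?\<tau> y)"
      by (simp only: sum_subtractf[symmetric] sum_distrib_left)
    also have "\<dots> = 0" by (simp only: stat[OF x] tree_weight_stationary[OF k x] mult_zero_right diff_zero)
    finally show "(\<Sum>y \<in> pverts G. k x y * f x - k y x * f y) = 0" .
  next
    show "f a = 0" using a pos[OF a(1)] by (simp add: f_def)
  qed (use a that in auto)
  then show ?thesis by (auto simp: f_def)
qed simp

lemma stationary_distribution_eq: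
  assumes "Digraph_Component.connected (with_proj G)" "jump_rates G k"
    "stationary_distribution G k \<rho>" "x \<in> pverts G"
  shows "\<rho> x = tree_weight G k x / normalization G k"
proof -
  from assms(3) have stat: "\<And>x. x \<in> pverts G \<Longrightarrow> (\<Sum>y \<in> pverts G. k x y * \<rho> x - k y x * \<rho> y) = 0"
    and total: "(\<Sum>x \<in> pverts G. \<rho> x) = 1"
    by (auto simp: stationary_distribution_def)
  obtain c where c: "\<And>x. x \<in> pverts G \<Longrightarrow> \<rho> x = c * tree_weight G k x"
    using stationary_proportional[OF assms(1,2) stat] by blast
  then have "c * normalization G k = 1"
    using total by (simp add: normalization_eq sum_distrib_left)
  \<comment> \<open>The equation just obtained also shows that the normalization is nonzero.\<close>
  then have "c = 1 / normalization G k" by (metis mult_zero_right nonzero_eq_divide_eq zero_neq_one)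
  with c assms(4) show ?thesis by simp
qed


section \<open>Unicyclic arc sets as oriented loops with hairs\<close>

text \<open>Hairs start off the cycle, so no arc of the union leaves \<open>Field C\<close>. Thus
  the vertices reachable from \<open>x\<close> are those of \<open>C\<close>, and the arcs out of
  them give \<open>C\<close> back.\<close>

lemma oriented_cycle_Un_hairs:
  assumes C: "C \<in> oriented_cycles G" and xy: "(x, y) \<in> C" and H: "H \<in> in_forests G (Field C)"
  shows "C \<union> H \<in> unicyclic G x" "(y, x) \<notin> C \<union> H" "(C \<union> H) \<inter> {u. (x, u) \<in> (C \<union> H)\<^sup>*} \<times> UNIV = C"
    "C \<inter> H = {}"
proof -
  have C': "C \<subseteq> parcs G" "directed_cycle C" "C \<inter> C\<inverse> = {}"
    using C by (auto simp: oriented_cycles_def)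
  note H' = in_forestsD[OF H]
  show disj: "C \<inter> H = {}" using H'(2) by (auto simp: Field_def)
  have "y \<in> Field C" using xy by (rule FieldI2)
  then show "(y, x) \<notin> C \<union> H" using C'(3) xy H'(2) by auto
  have CB: "C\<^sup>* \<subseteq> (C \<union> H)\<^sup>*" and HB: "H\<^sup>* \<subseteq> (C \<union> H)\<^sup>*" by (intro rtrancl_mono; blast)+
  have cyc: "(u, v) \<in> C\<^sup>*" if "u \<in> Field C" "v \<in> Field C" for u v
    using C'(2) that by (auto simp: directed_cycle_def)
  have x: "x \<in> Field C" using xy by (rule FieldI1)
  have closed: "u \<in> Field C" if "(x, u) \<in> (C \<union> H)\<^sup>*" for u
    using that x by (rule rtrancl_closed) (use H'(2) in \<open>auto simp: Field_def\<close>)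
  show "(C \<union> H) \<inter> {u. (x, u) \<in> (C \<union> H)\<^sup>*} \<times> UNIV = C"
  proof
    show "(C \<union> H) \<inter> {u. (x, u) \<in> (C \<union> H)\<^sup>*} \<times> UNIV \<subseteq> C" using closed H'(2) by auto
    show "C \<subseteq> (C \<union> H) \<inter> {u. (x, u) \<in> (C \<union> H)\<^sup>*} \<times> UNIV"
      using cyc[OF x] CB by (auto intro: FieldI1)
  qed
  have "(z, x) \<in> (C \<union> H)\<^sup>*" if z: "z \<in> pverts G" for z
  proof (cases "z \<in> Field C")
    case True
    with cyc x CB show ?thesis by blast
  next
    case False
    with z H'(4) obtain v where "v \<in> Field C" "(z, v) \<in> H\<^sup>*" by blast
    with cyc x CB HB show ?thesis by (meson rtrancl_trans subsetD)
  qed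
  moreover have "\<exists>!z'. (z, z') \<in> C \<union> H" if z: "z \<in> pverts G" for z
  proof (cases "z \<in> Field C")
    case True
    then obtain w where "(z, w) \<in> C" using directed_cycle_succ[OF C'(2)] by blast
    then show ?thesis using C'(2) H'(2)[OF True] by (auto simp: directed_cycle_def dest: single_valuedD)
  next
    case False
    then have "(z, w) \<notin> C" for w by (auto simp: Field_def)
    then show ?thesis using False z H'(3) by simp
  qed
  ultimately show "C \<union> H \<in> unicyclic G x" using C'(1) H'(1) by (simp add: unicyclic_def)
qed

text \<open>Every vertex reachable from \<open>x\<close> also leads back to \<open>x\<close>, so the
  arcs out of these vertices form one directed cycle; deleting them leaves the hairs.\<close>

lemma unicyclic_decompose:
  assumes B: "B \<in> unicyclic G x" and xy: "(x, y) \<in> B" and yx: "(y, x) \<notin> B"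
    and C_def: "C = B \<inter> {u. (x, u) \<in> B\<^sup>*} \<times> UNIV"
  shows "C \<in> oriented_cycles G" "(x, y) \<in> C" "B - C \<in> in_forests G (Field C)"
proof -
  note B' = unicyclicD[OF B] and sv = unicyclic_single_valued[OF B]
  show xyC: "(x, y) \<in> C" using xy by (simp add: C_def)
  have reach: "(x, u) \<in> C\<^sup>*" if "(x, u) \<in> B\<^sup>*" for u
    using that
  proof (induction rule: rtrancl_induct)
    case (step u v)
    then have "(u, v) \<in> C" by (simp add: C_def)
    with step.IH show ?case by (rule rtrancl_into_rtrancl)
  qed simp
  have Field_C: "u \<in> Field C \<longleftrightarrow> u \<in> pverts G \<and> (x, u) \<in> B\<^sup>*" for u
  proof
    assume "u \<in> Field C"
    then show "u \<in> pverts G \<and> (x, u) \<in> B\<^sup>*"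
      using B'(1) by (auto simp: Field_def C_def dest: in_arcsD1 in_arcsD2 intro: rtrancl_into_rtrancl)
  next
    assume u: "u \<in> pverts G \<and> (x, u) \<in> B\<^sup>*"
    then obtain v where "(u, v) \<in> B" using B'(2) by blast
    with u show "u \<in> Field C" by (auto simp: C_def intro!: FieldI1)
  qed
  have to_x: "(u, x) \<in> C\<^sup>*" if u: "u \<in> Field C" for u
  proof -
    have "(u, x) \<in> B\<^sup>*" using u Field_C B'(3) by blast
    then show ?thesis using u
    proof (induction rule: converse_rtrancl_induct)
      case (step u v)
      have "(x, u) \<in> B\<^sup>*" using step.prems Field_C by blast
      with step.hyps(1) have "(u, v) \<in> C" by (simp add: C_def)
      moreover from this have "v \<in> Field C" by (rule FieldI2)
      ultimately show ?case using step.IH by (meson converse_rtrancl_into_rtrancl)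
    qed simp
  qed
  have strong: "(u, v) \<in> C\<^sup>*" if "u \<in> Field C" "v \<in> Field C" for u v
    using to_x[OF that(1)] reach[of v] that(2) Field_C by (meson rtrancl_trans)
  have svC: "single_valued C" using sv by (auto simp: C_def single_valued_def)
  moreover have "a = b" if "(a, c) \<in> C" "(b, c) \<in> C" for a b c
  proof (rule single_valued_cycle_pred_unique[OF svC _ _ that])
    show "(c, a) \<in> C\<^sup>*" "(c, b) \<in> C\<^sup>*" using that by (blast intro: strong FieldI1 FieldI2)+
  qed
  ultimately have dc: "directed_cycle C"
    using xyC strong by (auto simp: directed_cycle_def intro!: single_valuedI)
  \<comment> \<open>Two opposite arcs would be all of \<open>C\<close>; as \<open>(x, y)\<close> is
    one of them, \<open>(y, x)\<close> would be the other.\<close>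
  have "C \<inter> C\<inverse> = {}"
  proof (rule ccontr)
    assume "C \<inter> C\<inverse> \<noteq> {}"
    then obtain a b where "(a, b) \<in> C" "(b, a) \<in> C" by auto
    with directed_cycle_2cycle[OF dc this] xyC have "(y, x) \<in> C" by auto
    with yx show False by (simp add: C_def)
  qed
  with dc B'(1) show "C \<in> oriented_cycles G" by (auto simp: oriented_cycles_def C_def)
  have eq: "B - C = B - Field C \<times> UNIV"
  proof -
    have "(u, v) \<in> C \<longleftrightarrow> u \<in> Field C" if "(u, v) \<in> B" for u v
    proof -
      have "u \<in> pverts G" using that B'(1) by (auto dest: in_arcsD1)
      with that have "(u, v) \<in> C \<longleftrightarrow> u \<in> pverts G \<and> (x, u) \<in> B\<^sup>*" by (simp add: C_def)
      then show ?thesis by (simp only: Field_C)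
    qed
    then show ?thesis by auto
  qed
  have x: "x \<in> Field C" using xyC by (rule FieldI1)
  show "B - C \<in> in_forests G (Field C)"
    unfolding eq in_forests_def
  proof (intro CollectI conjI ballI allI)
    fix z assume z: "z \<in> pverts G - Field C"
    show "\<exists>!z'. (z, z') \<in> B - Field C \<times> UNIV" using B'(2)[of z] z by simp
    show "\<exists>v \<in> Field C. (z, v) \<in> (B - Field C \<times> UNIV)\<^sup>*"
      using B'(3)[of z] z x by (intro rtrancl_first_hit) auto
  qed (use B'(1) in auto)
qed

lemma sum_unicyclic_hairs:
  "(\<Sum>B \<in> {B \<in> unicyclic G x. (x, y) \<in> B \<and> (y, x) \<notin> B}. weight k B)
    = (\<Sum>C \<in> {C \<in> oriented_cycles G. (x, y) \<in> C}. \<Sum>H \<in> in_forests G (Field C). weight k H * weight k C)"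
proof -
  let ?cyc = "\<lambda>B. B \<inter> {u. (x, u) \<in> B\<^sup>*} \<times> UNIV"
  have "finite (oriented_cycles G)"
    by (rule finite_subset[of _ "Pow (parcs G)"]) (auto simp: oriented_cycles_def pair_finite_arcs)
  then have "(\<Sum>C \<in> {C \<in> oriented_cycles G. (x, y) \<in> C}. \<Sum>H \<in> in_forests G (Field C). weight k H * weight k C)
    = (\<Sum>(C, H) \<in> Sigma {C \<in> oriented_cycles G. (x, y) \<in> C} (\<lambda>C. in_forests G (Field C)). weight k H * weight k C)"
    by (intro sum.Sigma) (auto simp: finite_in_forests)
  also have "\<dots> = (\<Sum>B \<in> {B \<in> unicyclic G x. (x, y) \<in> B \<and> (y, x) \<notin> B}. weight k B)"
  proof (rule sum.reindex_bij_witness[of _ "\<lambda>B. (?cyc B, B - ?cyc B)" "\<lambda>(C, H). C \<union> H"])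
    fix p assume "p \<in> Sigma {C \<in> oriented_cycles G. (x, y) \<in> C} (\<lambda>C. in_forests G (Field C))"
    then obtain C H where p: "p = (C, H)" and C: "C \<in> oriented_cycles G" "(x, y) \<in> C"
      and H: "H \<in> in_forests G (Field C)" by auto
    note CH = oriented_cycle_Un_hairs[OF C H]
    show "(?cyc (case p of (C, H) \<Rightarrow> C \<union> H), (case p of (C, H) \<Rightarrow> C \<union> H) - ?cyc (case p of (C, H) \<Rightarrow> C \<union> H)) = p"
      unfolding p prod.case CH(3) using CH(4) by auto
    show "(case p of (C, H) \<Rightarrow> C \<union> H) \<in> {B \<in> unicyclic G x. (x, y) \<in> B \<and> (y, x) \<notin> B}"
      using CH(1,2) C(2) by (simp add: p)
    have "C \<subseteq> parcs G" "H \<subseteq> parcs G"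
      using C in_forestsD(1)[OF H] by (auto simp: oriented_cycles_def)
    then have "finite C" "finite H" using pair_finite_arcs by (auto intro: finite_subset)
    then show "weight k (case p of (C, H) \<Rightarrow> C \<union> H) = (case p of (C, H) \<Rightarrow> weight k H * weight k C)"
      using CH(4) by (simp add: p weight_Un)
  next
    fix B assume "B \<in> {B \<in> unicyclic G x. (x, y) \<in> B \<and> (y, x) \<notin> B}"
    then have B: "B \<in> unicyclic G x" "(x, y) \<in> B" "(y, x) \<notin> B" by auto
    show "(case (?cyc B, B - ?cyc B) of (C, H) \<Rightarrow> C \<union> H) = B" by auto
    show "(?cyc B, B - ?cyc B) \<in> Sigma {C \<in> oriented_cycles G. (x, y) \<in> C} (\<lambda>C. in_forests G (Field C))"
      using unicyclic_decompose[OF B refl] by blast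
  qed
  finally show ?thesis by simp
qed

lemma tree_weight_current:
  assumes k: "jump_rates G k" and xy: "(x, y) \<in> parcs G"
  shows "tree_weight G k x * k x y - tree_weight G k y * k y x
    = (\<Sum>L \<in> loops_through G x y. \<Sum>H \<in> hairs G L.
        weight k H * (weight k (oriented_loop G L x y) - weight k (oriented_loop G L y x)))"
proof -
  have V: "x \<in> pverts G" "y \<in> pverts G" using xy by (auto dest: in_arcsD1 in_arcsD2)
  have split: "tree_weight G k a * k a b
    = (\<Sum>B \<in> {B \<in> unicyclic G a. (a, b) \<in> B \<and> (b, a) \<in> B}. weight k B)
      + (\<Sum>L \<in> loops_through G a b. \<Sum>H \<in> hairs G L. weight k H * weight k (oriented_loop G L a b))"
    if "a \<in> pverts G" "b \<in> pverts G" for a b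
  proof -
    have "{B \<in> unicyclic G a. (a, b) \<in> B}
      = {B \<in> unicyclic G a. (a, b) \<in> B \<and> (b, a) \<in> B} \<union> {B \<in> unicyclic G a. (a, b) \<in> B \<and> (b, a) \<notin> B}"
      by blast
    then have "tree_weight G k a * k a b
      = (\<Sum>B \<in> {B \<in> unicyclic G a. (a, b) \<in> B \<and> (b, a) \<in> B}. weight k B)
        + (\<Sum>B \<in> {B \<in> unicyclic G a. (a, b) \<in> B \<and> (b, a) \<notin> B}. weight k B)"
      unfolding tree_weight_times_rate[OF k that]
      by (simp only:) (rule sum.union_disjoint, auto simp: finite_unicyclic)
    also have "(\<Sum>B \<in> {B \<in> unicyclic G a. (a, b) \<in> B \<and> (b, a) \<notin> B}. weight k B)
      = (\<Sum>L \<in> loops_through G a b. \<Sum>H \<in> hairs G L. weight k H * weight k (oriented_loop G L a b))"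
      unfolding sum_unicyclic_hairs sum_loops_through[of "\<lambda>L C. \<Sum>H \<in> hairs G L. weight k H * weight k C"]
      by (simp add: hairs_eq_in_forests Field_symcl)
    finally show ?thesis .
  qed
  \<comment> \<open>With both arcs in \<open>B\<close> the reachability condition of
    \<open>unicyclic_shift\<close> holds in either direction, so the two families are equal and
    their sums cancel.\<close>
  have "{B \<in> unicyclic G x. (x, y) \<in> B \<and> (y, x) \<in> B} = {B \<in> unicyclic G y. (y, x) \<in> B \<and> (x, y) \<in> B}"
    using unicyclic_shift by blast
  then show ?thesis
    using split[OF V] split[OF V(2,1)] loops_through_commute[of x y]
    by (simp add: right_diff_distrib sum_subtractf)
qed

end

theorem mainTheorem3:
  fixes G :: "'a pair_pre_digraph"
    and k :: "'a \<Rightarrow> 'a \<Rightarrow> real"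
    and \<rho> :: "'a \<Rightarrow> real"
  assumes "pair_graph G"
    and "Digraph_Component.connected (with_proj G)"
    and "jump_rates G k"
    and "stationary_distribution G k \<rho>"
    and "(x, y) \<in> parcs G"
  shows "current k \<rho> x y =
    1 / normalization G k *
      (\<Sum>L \<in> loops_through G x y. \<Sum>H \<in> hairs G L.
        weight k H * (weight k (oriented_loop G L x y) - weight k (oriented_loop G L y x)))"
proof -
  interpret pair_graph G by fact
  have "x \<in> pverts G" "y \<in> pverts G" using assms(5) by (auto dest: in_arcsD1 in_arcsD2)
  then have "current k \<rho> x y = 1 / normalization G k * (tree_weight G k x * k x y - tree_weight G k y * k y x)"
    using stationary_distribution_eq[OF assms(2-4)] by (simp add: current_def diff_divide_distrib)
  then show ?thesis by (simp only: tree_weight_current[OF assms(3,5)])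
qed

end
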